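(* Let $H_n$ denote $\mathbb{R}^n$ or $\mathbb{C}^n$. Let $I=\{1,2,\ldots,k\}$ be a finite index set and let $P\subseteq 2^I$ be a collection of subsets of $I$, ordered by inclusion, which contains no singletons. If there exists a frame $F=\{f_i\}_{i\in I}\subseteq H_n\setminus\{0\}$ whose factor poset is $P$, then $P$ is span-closed, i.e., $[J]\notin \mathcal{I}(P)$ for every $J\in 2^I\setminus P$.
   Context: A frame for $H_n$ is a finite sequence $\{f_i\}_{i\in I}$ (repetitions allowed) spanning $H_n$. It is tight if there is $\lambda>0$ with $\sum_{i\in I}|\langle x,f_i\rangle|^2=\lambda\|x\|^2$ for all $x\in H_n$. The factor poset of a frame $F=\{f_i\}_{i\in I}$ is $\mathbb{F}_F=\{J\subseteq I:\{f_j\}_{j\in J}\text{ is a tight frame for }H_n\}$, ordered by inclusion, with the convention $\emptyset\in\mathbb{F}_F$. For $J\subseteq I=\{1,\dots,k\}$, the index vector is $[J]=\sum_{j\in J}e_j\in\mathbb{R}^k$, where $e_1,\dots,e_k$ is the standard basis. For $P\subseteq 2^I$, the index span is $\mathcal{I}(P)=\operatorname{span}_{\mathbb{R}}\{[J]:J\in P\}$. *)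

theory Defs
  imports "HOL-Analysis.Analysis"
begin

text \<open>
  The ambient space \<open>H\<close> is \<open>real ^ 'n\<close> or \<open>complex ^ 'n\<close>. The index set \<open>I\<close> is the universe of a
  finite type \<open>'k\<close>, so that \<open>k = CARD('k)\<close> and \<open>real ^ 'k\<close> is the space of index vectors.
\<close>

text \<open>
  The library inner product on \<open>complex ^ 'n\<close> is the real-valued one of the underlying real space,
  so the Hermitian one is defined here. It induces the library norm of \<open>complex ^ 'n\<close>.
\<close>

definition cinner :: "complex ^ 'n \<Rightarrow> complex ^ 'n \<Rightarrow> complex" where
  "cinner x y = (\<Sum>i\<in>UNIV. x $ i * cnj (y $ i))"

text \<open>
  Note that \<open>vec.span\<close> is the span over the scalar field \<open>'a\<close>. A family indexed by \<open>J\<close> may repeat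
  vectors; this matters for the sum in \<open>is_tight_frame\<close>, but not for the span.
\<close>

definition is_frame :: "('k::finite \<Rightarrow> 'a::field ^ 'n) \<Rightarrow> 'k set \<Rightarrow> bool" where
  "is_frame f J \<longleftrightarrow> vec.span (f ` J) = UNIV"

text \<open>The parameter \<open>ip\<close> is the inner product of the space: \<open>inner\<close> or \<open>cinner\<close>.\<close>

definition is_tight_frame ::
  "('a::real_normed_field ^ 'n \<Rightarrow> 'a ^ 'n \<Rightarrow> 'a) \<Rightarrow> ('k::finite \<Rightarrow> 'a ^ 'n) \<Rightarrow> 'k set \<Rightarrow> bool" where
  "is_tight_frame ip f J \<longleftrightarrow> is_frame f J \<and>
     (\<exists>c::real. c > 0 \<and> (\<forall>x. (\<Sum>j\<in>J. (norm (ip x (f j)))\<^sup>2) = c * (norm x)\<^sup>2))"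

text \<open>The empty family does not span, but belongs to the factor poset by convention.\<close>

definition factor_poset ::
  "('a::real_normed_field ^ 'n \<Rightarrow> 'a ^ 'n \<Rightarrow> 'a) \<Rightarrow> ('k::finite \<Rightarrow> 'a ^ 'n) \<Rightarrow> 'k set set" where
  "factor_poset ip f = {J. J = {} \<or> is_tight_frame ip f J}"

definition index_vector :: "'k::finite set \<Rightarrow> real ^ 'k" where
  "index_vector J = (\<Sum>j\<in>J. axis j 1)"

definition index_span :: "'k::finite set set \<Rightarrow> (real ^ 'k) set" where
  "index_span P = span (index_vector ` P)"

definition span_closed :: "'k::finite set set \<Rightarrow> bool" where
  "span_closed P \<longleftrightarrow> (\<forall>J \<in> Pow UNIV - P. index_vector J \<notin> index_span P)"

end

theory Submission
  imports Defs
begin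

text \<open>
  The weights \<open>w\<close> for which \<open>\<Sum>j. w\<^sub>j |\<langle>x, f\<^sub>j\<rangle>|\<^sup>2\<close> is a multiple of \<open>\<parallel>x\<parallel>\<^sup>2\<close> form a linear
  subspace of \<open>real ^ 'k\<close>. It contains the index vectors of the factor poset, hence their span.
  Conversely, if a nonempty \<open>J\<close> has its index vector in this subspace, the multiple is positive
  because the vectors are nonzero, so no nonzero vector is orthogonal to all \<open>f\<^sub>j\<close> with \<open>j \<in> J\<close>, and
  the subfamily is a tight frame.
\<close>

text \<open>The constant \<open>c\<close> may have any sign, since a condition \<open>c > 0\<close>
  would exclude the zero weight and so the subspace structure.\<close>

definition tight_weights ::
  "('a::real_normed_field ^ 'n \<Rightarrow> 'a ^ 'n \<Rightarrow> 'a) \<Rightarrow> ('k::finite \<Rightarrow> 'a ^ 'n) \<Rightarrow> (real ^ 'k) set" where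
  "tight_weights ip f =
     {w. \<exists>c::real. \<forall>x. (\<Sum>j\<in>UNIV. w $ j * (norm (ip x (f j)))\<^sup>2) = c * (norm x)\<^sup>2}"

lemma subspace_tight_weights: "subspace (tight_weights ip f)"
proof (rule subspaceI)
  show "0 \<in> tight_weights ip f"
    by (auto simp: tight_weights_def intro!: exI[of _ 0])
next
  fix v w assume "v \<in> tight_weights ip f" "w \<in> tight_weights ip f"
  then obtain c d where
    "\<forall>x. (\<Sum>j\<in>UNIV. v $ j * (norm (ip x (f j)))\<^sup>2) = c * (norm x)\<^sup>2"
    "\<forall>x. (\<Sum>j\<in>UNIV. w $ j * (norm (ip x (f j)))\<^sup>2) = d * (norm x)\<^sup>2"
    by (auto simp: tight_weights_def)
  then show "v + w \<in> tight_weights ip f"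
    by (auto simp: tight_weights_def distrib_right sum.distrib intro!: exI[of _ "c + d"])
next
  fix r w assume "w \<in> tight_weights ip f"
  then obtain c where
    "\<forall>x. (\<Sum>j\<in>UNIV. w $ j * (norm (ip x (f j)))\<^sup>2) = c * (norm x)\<^sup>2"
    by (auto simp: tight_weights_def)
  then show "r *\<^sub>R w \<in> tight_weights ip f"
    by (auto simp: tight_weights_def mult.assoc simp flip: sum_distrib_left
        intro!: exI[of _ "r * c"])
qed

lemma index_vector_nth: "index_vector J $ i = (if i \<in> J then 1 else 0)"
  by (simp add: index_vector_def axis_def)

lemma sum_index_vector: "(\<Sum>j\<in>UNIV. index_vector J $ j * g j) = sum g J"
  by (simp add: index_vector_nth if_distrib[of "\<lambda>t. t * _"] sum.If_cases cong: if_cong)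

lemma index_vector_in_tight_weights_iff:
  "index_vector J \<in> tight_weights ip f \<longleftrightarrow>
     (\<exists>c::real. \<forall>x. (\<Sum>j\<in>J. (norm (ip x (f j)))\<^sup>2) = c * (norm x)\<^sup>2)"
  by (simp add: tight_weights_def sum_index_vector)

text \<open>Real scalars act through \<open>of_real\<close>, so a span over the field is also a real
  subspace, to which real orthogonal complements apply.\<close>

lemma subspace_vec_span:
  fixes S :: "('a::real_normed_field ^ 'n) set"
  shows "subspace (vec.span S)"
proof (rule subspaceI)
  fix r :: real and x assume "x \<in> vec.span S"
  moreover have "r *\<^sub>R x = (of_real r :: 'a) *s x"
    by (simp add: vec_eq_iff scaleR_conv_of_real[where 'a = 'a])
  ultimately show "r *\<^sub>R x \<in> vec.span S"
    by (simp add: vec.span_scale)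
qed (auto intro: vec.span_zero vec.span_add)

lemma orthogonal_to_proper_subspace_exists:
  fixes T :: "'a::euclidean_space set"
  assumes "subspace T" and "T \<noteq> UNIV"
  obtains x where "x \<noteq> 0" and "\<And>y. y \<in> T \<Longrightarrow> inner x y = 0"
proof -
  have "span T \<noteq> UNIV"
    using assms by (simp add: span_eq_iff[THEN iffD2])
  then show ?thesis
    using span_not_UNIV_orthogonal[of T] assms(1) that
    by (metis span_base)
qed

text \<open>
  The last hypothesis holds because a scalar subspace is closed under multiplication by the
  imaginary unit, so that real orthogonality to it is Hermitian orthogonality.
\<close>

lemma span_closed_factor_poset:
  fixes ip :: "'a::{real_normed_field, euclidean_space} ^ 'n \<Rightarrow> 'a ^ 'n \<Rightarrow> 'a"
    and f :: "'k::finite \<Rightarrow> 'a ^ 'n"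
  assumes nonzero: "\<And>i. f i \<noteq> 0"
    and definite: "\<And>x. x \<noteq> 0 \<Longrightarrow> ip x x \<noteq> 0"
    and orth: "\<And>T x y. vec.subspace T \<Longrightarrow> (\<And>z. z \<in> T \<Longrightarrow> inner x z = 0) \<Longrightarrow> y \<in> T \<Longrightarrow> ip x y = 0"
  shows "span_closed (factor_poset ip f)"
  unfolding span_closed_def
proof (intro ballI notI)
  fix J assume J: "J \<in> Pow UNIV - factor_poset ip f"
    and "index_vector J \<in> index_span (factor_poset ip f)"
  \<comment> \<open>The witness 0 serves the empty set, which is in the poset by convention.\<close>
  moreover have "index_vector ` factor_poset ip f \<subseteq> tight_weights ip f"
    by (auto simp: index_vector_in_tight_weights_iff factor_poset_def is_tight_frame_def
        intro: exI[of _ 0])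
  then have "index_span (factor_poset ip f) \<subseteq> tight_weights ip f"
    unfolding index_span_def by (rule span_minimal[OF _ subspace_tight_weights])
  ultimately have "index_vector J \<in> tight_weights ip f"
    by blast
  then obtain c
    where c: "\<And>x. (\<Sum>j\<in>J. (norm (ip x (f j)))\<^sup>2) = c * (norm x)\<^sup>2"
    by (auto simp: index_vector_in_tight_weights_iff)
  from J obtain i where i: "i \<in> J"
    by (auto simp: factor_poset_def)
  \<comment> \<open>Evaluating the identity at \<open>x = f i\<close> shows the sign of
    \<open>c\<close>: the term \<open>j = i\<close> alone is positive.\<close>
  have "0 < (norm (ip (f i) (f i)))\<^sup>2"
    using definite nonzero by simp
  also have "\<dots> \<le> (\<Sum>j\<in>J. (norm (ip (f i) (f j)))\<^sup>2)"
    using i by (intro member_le_sum) auto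
  finally have "c > 0"
    by (simp add: c zero_less_mult_iff nonzero)
  moreover have "vec.span (f ` J) = UNIV"
  proof (rule ccontr)
    assume "vec.span (f ` J) \<noteq> UNIV"
    then obtain x where x: "x \<noteq> 0" "\<And>y. y \<in> vec.span (f ` J) \<Longrightarrow> inner x y = 0"
      using orthogonal_to_proper_subspace_exists[OF subspace_vec_span] by blast
    then have "ip x (f j) = 0" if "j \<in> J" for j
      using orth[OF vec.subspace_span] that by (meson imageI vec.span_base)
    \<comment> \<open>Every term of the sum vanishes at this \<open>x\<close>.\<close>
    then have "c * (norm x)\<^sup>2 = 0"
      by (simp flip: c)
    with x \<open>c > 0\<close> show False
      by simp
  qed
  ultimately have "is_tight_frame ip f J"
    using c by (auto simp: is_tight_frame_def is_frame_def)
  with J show False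
    by (simp add: factor_poset_def)
qed

lemma Re_cinner: "Re (cinner x y) = inner x y"
  by (simp add: cinner_def inner_vec_def inner_complex_def)

text \<open>Conjugate linearity in the second argument turns the factor \<open>\<i>\<close> into
  \<open>-\<i>\<close>, and the real part of \<open>-\<i> * z\<close> is
  \<open>Im z\<close>.\<close>

lemma Im_cinner: "Im (cinner x y) = inner x (\<i> *s y)"
  by (simp add: cinner_def inner_vec_def inner_complex_def algebra_simps)

theorem theorem6:
  fixes P :: "'k::finite set set"
  assumes no_singletons: "\<forall>i. {i} \<notin> P"
    and realizable:
      "(\<exists>f :: 'k \<Rightarrow> real ^ 'n. is_frame f UNIV \<and> (\<forall>i. f i \<noteq> 0) \<and> factor_poset inner f = P) \<or>
       (\<exists>f :: 'k \<Rightarrow> complex ^ 'n. is_frame f UNIV \<and> (\<forall>i. f i \<noteq> 0) \<and> factor_poset cinner f = P)"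
  shows "span_closed P"
  using realizable
proof (elim disjE exE conjE)
  fix f :: "'k \<Rightarrow> real ^ 'n"
  assume "\<forall>i. f i \<noteq> 0" and P: "factor_poset inner f = P"
  then show ?thesis
    unfolding P[symmetric] by (intro span_closed_factor_poset) auto
next
  fix f :: "'k \<Rightarrow> complex ^ 'n"
  assume nonzero: "\<forall>i. f i \<noteq> 0" and P: "factor_poset cinner f = P"
  show ?thesis
    unfolding P[symmetric]
  proof (rule span_closed_factor_poset)
    fix x :: "complex ^ 'n" assume "x \<noteq> 0"
    then show "cinner x x \<noteq> 0"
      by (metis Re_cinner inner_eq_zero_iff zero_complex.sel(1))
  next
    fix T :: "(complex ^ 'n) set" and x y
    assume "vec.subspace T" "\<And>z. z \<in> T \<Longrightarrow> inner x z = 0" "y \<in> T"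
    \<comment> \<open>Both \<open>y\<close> and \<open>\<i> *s y\<close> lie in \<open>T\<close>,
      which kills the real and the imaginary part.\<close>
    then show "cinner x y = 0"
      by (simp add: complex_eq_iff Re_cinner Im_cinner vec.subspace_scale)
  qed (use nonzero in simp)
qed

end
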